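(* Let $\Omega$ be a nonempty set. Assume that $Y$ is a Lindenstrauss space and that the nonempty bounded set $M\subseteq\mathcal B(\Omega,Y)$ is pointwise relatively compact. Then $\omega_{\mathcal B}(M)\le\alpha(M)$.
   Context: A real Banach space $Y$ is a Lindenstrauss space if its dual $Y^*$ is isometric to $L^1(\mu)$ for some measure $\mu$. $\mathcal B=\mathcal B(\Omega,Y)$ is the Banach space of all bounded functions $f:\Omega\to Y$ with norm $\|f\|_\infty=\sup_{x\in\Omega}\|f(x)\|$. For a nonempty bounded subset of a Banach space, the Kuratowski measure of noncompactness $\alpha$ is the infimum of all $\varepsilon>0$ such that the set can be covered by finitely many sets of diameter not greater than $\varepsilon$. $M$ is pointwise relatively compact if $\sup_{x\in\Omega}\alpha(M(x))=0$, where $M(x)=\{f(x):f\in M\}$; equivalently each $M(x)$ is relatively compact in $Y$. $\omega_{\mathcal B}(M)$ is the infimum of all $\varepsilon>0$ for which there are a finite partition $\{A_1,\dots,A_n\}$ of $\Omega$ and a finite set $\{\varphi_1,\dots,\varphi_m\}\subseteq\mathcal B(\Omega,Y)$ such that for every $f\in M$ there is $j\in\{1,\dots,m\}$ with $\operatorname{diam}((f-\varphi_j)(A_i))\le\varepsilon$ for all $i=1,\dots,n$. *)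

theory Defs
  imports "HOL-Analysis.Analysis"
begin

(* \<open>Met_TC.fspace \<Omega>\<close> and \<open>Met_TC.fdist \<Omega>\<close> are the library's space of bounded functions on
   the set \<Omega> with values in a metric type, and its sup distance. Its elements are extensional,
   i.e. equal to \<open>undefined\<close> off \<Omega>, so that they correspond to functions \<Omega> \<rightarrow> Y. *)

abbreviation bounded_funs :: "'w set \<Rightarrow> ('w \<Rightarrow> 'y::real_normed_vector) set" where
  "bounded_funs \<Omega> \<equiv> Met_TC.fspace \<Omega>"

abbreviation sup_dist ::
    "'w set \<Rightarrow> ('w \<Rightarrow> 'y::real_normed_vector) \<Rightarrow> ('w \<Rightarrow> 'y) \<Rightarrow> real" where
  "sup_dist \<Omega> \<equiv> Met_TC.fdist \<Omega>"

lemma sup_dist_eq_sup_norm: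
  assumes "\<Omega> \<noteq> {}" "f \<in> bounded_funs \<Omega>" "g \<in> bounded_funs \<Omega>"
  shows "sup_dist \<Omega> f g = (SUP x\<in>\<Omega>. norm (f x - g x))"
  using assms by (simp add: Met_TC.fdist_def dist_norm)

(* Extended-valued, because the library's \<open>diameter\<close> says nothing useful about unbounded sets. *)
definition ediam :: "('a \<Rightarrow> 'a \<Rightarrow> real) \<Rightarrow> 'a set \<Rightarrow> ennreal" where
  "ediam d S = (SUP x\<in>S. SUP y\<in>S. ennreal (d x y))"

definition kuratowski_mnc :: "'a set \<Rightarrow> ('a \<Rightarrow> 'a \<Rightarrow> real) \<Rightarrow> 'a set \<Rightarrow> real" where
  "kuratowski_mnc X d A =
     Inf {\<epsilon>. \<epsilon> > 0 \<and>
            (\<exists>\<C>. finite \<C> \<and> (\<forall>S\<in>\<C>. S \<subseteq> X \<and> ediam d S \<le> ennreal \<epsilon>) \<and> A \<subseteq> \<Union>\<C>)}"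

definition pointwise_relatively_compact ::
    "'w set \<Rightarrow> ('w \<Rightarrow> 'y::real_normed_vector) set \<Rightarrow> bool" where
  "pointwise_relatively_compact \<Omega> M \<longleftrightarrow>
     (SUP x\<in>\<Omega>. kuratowski_mnc UNIV dist ((\<lambda>f. f x) ` M)) = 0"

(* The library's \<open>diameter\<close> is adequate here: differences of bounded functions have bounded range. *)
definition omega_B :: "'w set \<Rightarrow> ('w \<Rightarrow> 'y::real_normed_vector) set \<Rightarrow> real" where
  "omega_B \<Omega> M =
     Inf {\<epsilon>. \<epsilon> > 0 \<and>
            (\<exists>\<A> \<Phi>. finite \<A> \<and> partition_on \<Omega> \<A> \<and> finite \<Phi> \<and> \<Phi> \<subseteq> bounded_funs \<Omega> \<and>
               (\<forall>f\<in>M. \<exists>\<phi>\<in>\<Phi>. \<forall>A\<in>\<A>. diameter ((\<lambda>x. f x - \<phi> x) ` A) \<le> \<epsilon>))}"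

(* A linear isometry of a normed space onto \<open>L\<^sup>1(\<mu>)\<close>. The map T picks a representative
   of each class, so equalities in \<open>L\<^sup>1(\<mu>)\<close> are equalities almost everywhere. *)
definition isometry_onto_L1 :: "'m measure \<Rightarrow> ('e::real_normed_vector \<Rightarrow> 'm \<Rightarrow> real) \<Rightarrow> bool" where
  "isometry_onto_L1 \<mu> T \<longleftrightarrow>
     (\<forall>u. integrable \<mu> (T u)) \<and>
     (\<forall>u v. AE t in \<mu>. T (u + v) t = T u t + T v t) \<and>
     (\<forall>c u. AE t in \<mu>. T (c *\<^sub>R u) t = c * T u t) \<and>
     (\<forall>u. (LINT t|\<mu>. \<bar>T u t\<bar>) = norm u) \<and>
     (\<forall>g. integrable \<mu> g \<longrightarrow> (\<exists>u. AE t in \<mu>. T u t = g t))"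

(* \<open>Y\<^sup>*\<close> is isometric to \<open>L\<^sup>1(\<mu>)\<close>. HOL cannot quantify existentially over the type carrying \<mu>;
   as a hypothesis with \<mu> and its type free, this says precisely that Y is a Lindenstrauss space. *)
definition lindenstrauss_space :: "'y::banach itself \<Rightarrow> 'm measure \<Rightarrow> bool" where
  "lindenstrauss_space _ \<mu> \<longleftrightarrow> (\<exists>T :: ('y \<Rightarrow>\<^sub>L real) \<Rightarrow> 'm \<Rightarrow> real. isometry_onto_L1 \<mu> T)"

end

theory Submission
  imports Defs
begin

text \<open>Cover \<open>M\<close> by finitely many sets \<open>S\<close> of diameter at most \<open>\<epsilon>\<close>. Each \<open>S(x)\<close> is relatively
  compact of diameter at most \<open>\<epsilon>\<close>, and in a Lindenstrauss space such a set lies in a ball of any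
  radius larger than \<open>\<epsilon> / 2\<close>. A choice of centres \<open>\<phi>\<^sub>S(x)\<close> gives bounded functions for which the
  trivial partition of \<open>\<Omega>\<close> already works.

  For the balls, total boundedness reduces to finite sets \<open>F\<close>. By Hahn--Banach, applied to the
  distance of the point \<open>(a)\<^bsub>a\<in>F\<^esub>\<close> of \<open>Y\<^sup>F\<close> to the diagonal, it suffices that
  \<open>\<Sum>\<^sub>a u\<^sub>a(a) \<le> r \<Sum>\<^sub>a \<parallel>u\<^sub>a\<parallel>\<close> whenever \<open>\<Sum>\<^sub>a u\<^sub>a = 0\<close> in \<open>Y\<^sup>*\<close> and \<open>F\<close> has diameter at most \<open>2 r\<close>. In
  \<open>L\<^sup>1(\<mu>)\<close> one can write \<open>u\<^sub>a = \<Sum>\<^sub>b v\<^sub>a\<^sub>b\<close> with \<open>v\<close> antisymmetric and \<open>\<parallel>u\<^sub>a\<parallel> = \<Sum>\<^sub>b \<parallel>v\<^sub>a\<^sub>b\<parallel>\<close>, and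
  then the left-hand side is half of \<open>\<Sum>\<^sub>a\<^sub>b v\<^sub>a\<^sub>b(a - b)\<close>.\<close>

section \<open>Sublinear functionals and the Hahn--Banach theorem\<close>

definition sublinear :: "('a::real_vector \<Rightarrow> real) \<Rightarrow> bool" where
  "sublinear p \<longleftrightarrow> (\<forall>x y. p (x + y) \<le> p x + p y) \<and> (\<forall>c x. c > 0 \<longrightarrow> p (c *\<^sub>R x) \<le> c * p x)"

lemma sublinear_add: "sublinear p \<Longrightarrow> p (x + y) \<le> p x + p y"
  by (simp add: sublinear_def)

lemma sublinear_scale:
  assumes "sublinear p" "c > 0"
  shows "p (c *\<^sub>R x) = c * p x"
proof (rule antisym)
  show "p (c *\<^sub>R x) \<le> c * p x"
    using assms by (simp add: sublinear_def)
  have "p ((1 / c) *\<^sub>R (c *\<^sub>R x)) \<le> (1 / c) * p (c *\<^sub>R x)"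
    using assms unfolding sublinear_def by (metis zero_less_divide_1_iff)
  then show "c * p x \<le> p (c *\<^sub>R x)"
    using assms(2) by (simp add: field_simps)
qed

lemma sublinear_zero:
  assumes "sublinear p"
  shows "p 0 = 0"
  using sublinear_scale[OF assms, of 2 0] by simp

lemma sublinear_minus: "sublinear p \<Longrightarrow> - p (- x) \<le> p x"
  using sublinear_add[of p x "- x"] sublinear_zero[of p] by simp

text \<open>Take the infimum over shifts along the ray of \<open>x0\<close>, charging
  \<open>t * p x0\<close>. Sublinearity survives because shift parameters add and scale, and
  \<open>t = 1\<close> at \<open>- x0\<close> gives the last bound. This serves both to fix the
  value at one point and to show that minimal functionals are odd.\<close>

lemma sublinear_lower:
  fixes p :: "'a::real_vector \<Rightarrow> real"
  assumes p: "sublinear p"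
  obtains q where "sublinear q" "\<And>x. q x \<le> p x" "q (- x0) \<le> - p x0"
proof
  define q where "q x = (INF t\<in>{0..}. p (x + t *\<^sub>R x0) - t * p x0)" for x
  have p_pos: "p (t *\<^sub>R x) = t * p x" if "t \<ge> 0" for t x
    using that sublinear_scale[OF p, of t x] sublinear_zero[OF p] by (cases "t = 0") auto
  have bdd: "bdd_below ((\<lambda>t. p (x + t *\<^sub>R x0) - t * p x0) ` {0..})" for x
  proof (rule bdd_belowI2)
    fix t :: real assume "t \<in> {0..}"
    then show "- p (- x) \<le> p (x + t *\<^sub>R x0) - t * p x0"
      using sublinear_add[OF p, of "x + t *\<^sub>R x0" "- x"] p_pos[of t x0] by simp
  qed
  have le: "q x \<le> p (x + t *\<^sub>R x0) - t * p x0" if "t \<ge> 0" for x t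
    unfolding q_def using that by (intro cINF_lower bdd) auto
  have ge: "b \<le> q x" if "\<And>t. t \<ge> 0 \<Longrightarrow> b \<le> p (x + t *\<^sub>R x0) - t * p x0" for b x
    unfolding q_def using that by (intro cINF_greatest) auto
  show "sublinear q"
    unfolding sublinear_def
  proof (intro conjI allI impI)
    fix x y
    have "q (x + y) - (p (y + s *\<^sub>R x0) - s * p x0) \<le> q x" if "s \<ge> 0" for s
    proof (rule ge)
      fix t :: real assume "t \<ge> 0"
      then show "q (x + y) - (p (y + s *\<^sub>R x0) - s * p x0) \<le> p (x + t *\<^sub>R x0) - t * p x0"
        using le[of "s + t" "x + y"] sublinear_add[OF p, of "x + t *\<^sub>R x0" "y + s *\<^sub>R x0"] that
        by (simp add: algebra_simps)
    qed
    then have "q (x + y) - q x \<le> q y"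
      by (intro ge) (simp add: algebra_simps)
    then show "q (x + y) \<le> q x + q y"
      by simp
  next
    fix c :: real and x assume c: "c > 0"
    have "q (c *\<^sub>R x) / c \<le> q x"
    proof (rule ge)
      fix t :: real assume "t \<ge> 0"
      then have "q (c *\<^sub>R x) \<le> p (c *\<^sub>R (x + t *\<^sub>R x0)) - c * t * p x0"
        using le[of "c * t" "c *\<^sub>R x"] c by (simp add: algebra_simps)
      then show "q (c *\<^sub>R x) / c \<le> p (x + t *\<^sub>R x0) - t * p x0"
        using c unfolding sublinear_scale[OF p c] by (simp add: field_simps)
    qed
    then show "q (c *\<^sub>R x) \<le> c * q x"
      using c by (simp add: field_simps)
  qed
  show "q x \<le> p x" for x
    using le[of 0 x] by simp
  show "q (- x0) \<le> - p x0"
    using le[of 1 "- x0"] sublinear_zero[OF p] by simp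
qed

text \<open>Zorn's lemma downwards. The pointwise infimum of a chain is finite because any sublinear
  \<open>q\<close> below \<open>p\<close> satisfies
  \<open>- p (- x) \<le> - q (- x) \<le> q x\<close>.\<close>

lemma minimal_sublinear:
  fixes p :: "'a::real_vector \<Rightarrow> real"
  assumes p: "sublinear p"
  obtains m where "sublinear m" "\<And>x. m x \<le> p x"
    "\<And>q. sublinear q \<Longrightarrow> (\<And>x. q x \<le> m x) \<Longrightarrow> q = m"
proof -
  define Q where "Q = {q. sublinear q \<and> (\<forall>x. q x \<le> p x)}"
  \<comment> \<open>The order is reversed, so that a maximal element for \<open>R\<close> is
    pointwise minimal.\<close>
  define R where "R = (\<lambda>q q' :: 'a \<Rightarrow> real. \<forall>x. q' x \<le> q x)"
  have "\<exists>m\<in>Q. \<forall>q\<in>Q. R m q \<longrightarrow> q = m"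
  proof (rule predicate_Zorn)
    show "partial_order_on Q (relation_of R Q)"
      by (rule partial_order_on_relation_ofI) (auto simp: R_def fun_eq_iff intro: order_trans antisym)
    fix C assume C: "C \<in> Chains (relation_of R Q)"
    show "\<exists>u\<in>Q. \<forall>q\<in>C. R q u"
    proof (cases "C = {}")
      case True
      then show ?thesis using p by (auto simp: Q_def)
    next
      case False
      have total: "R q q' \<or> R q' q" if "q \<in> C" "q' \<in> C" for q q'
        using C that by (auto simp: Chains_def relation_of_def)
      have CQ: "C \<subseteq> Q"
        using C by (auto simp: Chains_def relation_of_def)
      define u where "u x = (INF q\<in>C. q x)" for x
      have bdd: "bdd_below ((\<lambda>q. q x) ` C)" for x
      proof (rule bdd_belowI2)
        fix q assume "q \<in> C"
        then have "sublinear q" "q (- x) \<le> p (- x)"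
          using CQ by (auto simp: Q_def)
        then show "- p (- x) \<le> q x"
          using sublinear_minus[of q x] by simp
      qed
      have le: "u x \<le> q x" if "q \<in> C" for x q
        unfolding u_def using that by (intro cINF_lower bdd)
      have ge: "b \<le> u x" if "\<And>q. q \<in> C \<Longrightarrow> b \<le> q x" for b x
        unfolding u_def using that False by (intro cINF_greatest)
      have "sublinear u"
        unfolding sublinear_def
      proof (intro conjI allI impI)
        fix x y
        \<comment> \<open>The smaller of \<open>q\<close> and \<open>q'\<close> is a single
          functional to which subadditivity applies.\<close>
        have "u (x + y) \<le> q x + q' y" if q: "q \<in> C" "q' \<in> C" for q q'
        proof -
          obtain r where r: "r \<in> C" "\<And>z. r z \<le> q z" "\<And>z. r z \<le> q' z"
            using total[OF q] q by (auto simp: R_def)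
          then have "sublinear r"
            using CQ by (auto simp: Q_def)
          then show ?thesis
            using le[OF r(1), of "x + y"] sublinear_add[of r x y] r(2)[of x] r(3)[of y] by linarith
        qed
        then have "u (x + y) - q' y \<le> u x" if "q' \<in> C" for q'
          using that by (intro ge) (simp add: algebra_simps)
        then have "u (x + y) - u x \<le> u y"
          by (intro ge) (simp add: algebra_simps)
        then show "u (x + y) \<le> u x + u y"
          by simp
      next
        fix c :: real and x assume c: "c > 0"
        have "u (c *\<^sub>R x) / c \<le> u x"
        proof (rule ge)
          fix q assume q: "q \<in> C"
          then have "sublinear q"
            using CQ by (auto simp: Q_def)
          then show "u (c *\<^sub>R x) / c \<le> q x"
            using le[OF q, of "c *\<^sub>R x"] c by (simp add: sublinear_scale field_simps)
        qed
        then show "u (c *\<^sub>R x) \<le> c * u x"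
          using c by (simp add: field_simps)
      qed
      moreover have "u x \<le> p x" for x
        using False le CQ unfolding Q_def by (smt (verit) all_not_in_conv mem_Collect_eq subsetD)
      ultimately have "u \<in> Q"
        by (simp add: Q_def)
      then show ?thesis
        using le by (auto simp: R_def)
    qed
  qed
  then obtain m where m: "m \<in> Q" "\<And>q. q \<in> Q \<Longrightarrow> R m q \<Longrightarrow> q = m"
    by blast
  show thesis
  proof (rule that[of m])
    fix q assume q: "sublinear q" "\<And>x. q x \<le> m x"
    then show "q = m"
      using m by (intro m(2)) (auto simp: Q_def R_def intro: order_trans)
  qed (use m in \<open>auto simp: Q_def\<close>)
qed

text \<open>Lowering a minimal sublinear \<open>L\<close> at \<open>x\<close> returns
  \<open>L\<close> itself, so \<open>L (- x) = - L x\<close>, and oddness turns subadditivity into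
  additivity. Lowering \<open>p\<close> at \<open>x0\<close> before minimising pins the value
  there.\<close>

theorem hahn_banach_sublinear:
  fixes p :: "'a::real_vector \<Rightarrow> real"
  assumes "sublinear p"
  obtains L where "linear L" "\<And>x. L x \<le> p x" "L x0 = p x0"
proof -
  obtain p' where p': "sublinear p'" "\<And>x. p' x \<le> p x" "p' (- x0) \<le> - p x0"
    using sublinear_lower[OF assms, of x0] by blast
  obtain L where L: "sublinear L" "\<And>x. L x \<le> p' x"
      "\<And>q. sublinear q \<Longrightarrow> (\<And>x. q x \<le> L x) \<Longrightarrow> q = L"
    using minimal_sublinear[OF p'(1)] by blast
  have minus: "L (- x) = - L x" for x
  proof (rule antisym)
    obtain q where "sublinear q" "\<And>y. q y \<le> L y" "q (- x) \<le> - L x"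
      using sublinear_lower[OF L(1), of x] by blast
    then show "L (- x) \<le> - L x"
      using L(3) by metis
    show "- L x \<le> L (- x)"
      using sublinear_minus[OF L(1), of "- x"] by simp
  qed
  have "linear L"
  proof (rule linearI)
    fix x y
    show "L (x + y) = L x + L y"
      using sublinear_add[OF L(1), of x y] sublinear_add[OF L(1), of "- x" "- y"]
        minus[of x] minus[of y] minus[of "x + y"] by simp
  next
    fix c :: real and x
    consider "c > 0" | "c = 0" | "- c > 0"
      by linarith
    then show "L (c *\<^sub>R x) = c *\<^sub>R L x"
    proof cases
      case 3
      then show ?thesis
        using sublinear_scale[OF L(1) 3, of x] minus[of "c *\<^sub>R x"] by simp
    qed (use L(1) in \<open>simp_all add: sublinear_scale sublinear_zero\<close>)
  qed
  moreover have "L x \<le> p x" for x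
    using L(2) p'(2) order_trans by blast
  moreover have "p x0 \<le> L x0"
    using L(2)[of "- x0"] p'(3) minus[of x0] by simp
  ultimately show thesis
    using that by (metis antisym)
qed

text \<open>The distance to \<open>S\<close> is sublinear, lies below the norm and vanishes on
  \<open>S\<close>. A linear functional below it is at most 0 at both \<open>x\<close> and
  \<open>- x\<close> for \<open>x\<close> in \<open>S\<close>.\<close>

lemma functional_attaining_infdist:
  fixes S :: "'a::real_normed_vector set"
  assumes S: "subspace S"
  obtains L :: "'a \<Rightarrow> real" where "linear L" "\<And>x. L x \<le> norm x" "\<And>x. x \<in> S \<Longrightarrow> L x = 0"
    "L x0 = infdist x0 S"
proof -
  have ne: "S \<noteq> {}"
    using subspace_0[OF S] by blast
  have le: "infdist x S \<le> norm (x - s)" if "s \<in> S" for x s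
    using infdist_le[OF that, of x] by (simp add: dist_norm)
  have ge: "b \<le> infdist x S" if "\<And>s. s \<in> S \<Longrightarrow> b \<le> norm (x - s)" for b x
    using ne that by (auto simp: infdist_notempty dist_norm intro: cINF_greatest)
  have "sublinear (\<lambda>x. infdist x S)"
    unfolding sublinear_def
  proof (intro conjI allI impI)
    fix x y
    have "infdist (x + y) S - norm (y - t) \<le> infdist x S" if t: "t \<in> S" for t
    proof (rule ge)
      fix s assume "s \<in> S"
      then show "infdist (x + y) S - norm (y - t) \<le> norm (x - s)"
        using le[of "s + t" "x + y"] t subspace_add[OF S, of s t]
          norm_triangle_ineq[of "x - s" "y - t"] by (simp add: algebra_simps)
    qed
    then have "infdist (x + y) S - infdist x S \<le> infdist y S"
      by (intro ge) (simp add: algebra_simps)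
    then show "infdist (x + y) S \<le> infdist x S + infdist y S"
      by simp
  next
    fix c :: real and x assume c: "c > 0"
    have "infdist (c *\<^sub>R x) S / c \<le> infdist x S"
    proof (rule ge)
      fix s assume "s \<in> S"
      then have "infdist (c *\<^sub>R x) S \<le> norm (c *\<^sub>R (x - s))"
        using le[of "c *\<^sub>R s" "c *\<^sub>R x"] subspace_scale[OF S, of s c]
        by (metis scaleR_diff_right)
      then have "infdist (c *\<^sub>R x) S \<le> c * norm (x - s)"
        using c by simp
      then show "infdist (c *\<^sub>R x) S / c \<le> norm (x - s)"
        using c by (simp add: field_simps)
    qed
    then show "infdist (c *\<^sub>R x) S \<le> c * infdist x S"
      using c by (simp add: field_simps)
  qed
  then obtain L where L: "linear L" "\<And>x. L x \<le> infdist x S" "L x0 = infdist x0 S"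
    using hahn_banach_sublinear[of "\<lambda>x. infdist x S" x0] by blast
  show thesis
  proof (rule that[OF L(1) _ _ L(3)])
    show "L x \<le> norm x" for x
      using L(2)[of x] le[OF subspace_0[OF S], of x] by simp
    show "L x = 0" if "x \<in> S" for x
      using L(2)[of x] L(2)[of "- x"] that subspace_neg[OF S that] linear_neg[OF L(1), of x]
      by simp
  qed
qed

section \<open>Transport splitting of zero-sum families, for numbers and in an L1 space\<close>

text \<open>A zero-sum family is split as in a transport problem: the positive parts supply the
  negative parts proportionally. If the total supply vanishes, so do all \<open>g a\<close>, and the junk
  value \<open>x / 0 = 0\<close> is the right one.\<close>

definition transport :: "'i set \<Rightarrow> ('i \<Rightarrow> real) \<Rightarrow> 'i \<Rightarrow> 'i \<Rightarrow> real" where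
  "transport F g a b =
     (max (g a) 0 * max (- g b) 0 - max (- g a) 0 * max (g b) 0) / (\<Sum>c\<in>F. max (g c) 0)"

lemma transport_swap: "transport F g b a = - transport F g a b"
  by (simp add: transport_def minus_divide_left del: divide_minus_left)

text \<open>Total supply equals total demand because \<open>g\<close> sums to 0. No entry of row
  \<open>a\<close> has the sign opposite to \<open>g a\<close>, so absolute values add without
  cancellation.\<close>

lemma transport_sums:
  assumes "finite F" "(\<Sum>a\<in>F. g a) = 0" "a \<in> F"
  shows "(\<Sum>b\<in>F. transport F g a b) = g a" "(\<Sum>b\<in>F. \<bar>transport F g a b\<bar>) = \<bar>g a\<bar>"
proof -
  define S where "S = (\<Sum>c\<in>F. max (g c) 0)"
  have "S - (\<Sum>c\<in>F. max (- g c) 0) = (\<Sum>c\<in>F. g c)"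
    unfolding S_def sum_subtractf[symmetric] by (intro sum.cong) auto
  then have neg: "(\<Sum>c\<in>F. max (- g c) 0) = S"
    using assms(2) by simp
  have "S \<ge> 0"
    unfolding S_def by (intro sum_nonneg) auto
  have "max (g a) 0 \<le> S"
    unfolding S_def using assms by (intro member_le_sum) auto
  moreover have "max (- g a) 0 \<le> S"
    unfolding neg[symmetric] using assms by (intro member_le_sum) auto
  ultimately have zero: "g a = 0" if "S = 0"
    using that by auto
  have "(\<Sum>b\<in>F. transport F g a b) = (max (g a) 0 - max (- g a) 0) * S / S"
    unfolding transport_def S_def[symmetric] sum_divide_distrib[symmetric] sum_subtractf
      sum_distrib_left[symmetric] neg by (simp add: left_diff_distrib)
  also have "\<dots> = g a"
    using zero by (cases "S = 0") auto
  finally show "(\<Sum>b\<in>F. transport F g a b) = g a" .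
  have "\<bar>transport F g a b\<bar> = (max (g a) 0 * max (- g b) 0 + max (- g a) 0 * max (g b) 0) / S" for b
    using \<open>S \<ge> 0\<close> unfolding transport_def S_def[symmetric]
    by (cases "g a \<ge> 0") (simp_all add: abs_mult max_absorb1 max_absorb2)
  then have "(\<Sum>b\<in>F. \<bar>transport F g a b\<bar>) = (max (g a) 0 + max (- g a) 0) * S / S"
    unfolding S_def[symmetric] by (simp only: sum_divide_distrib[symmetric] sum.distrib
      sum_distrib_left[symmetric] neg distrib_right S_def[symmetric])
  also have "\<dots> = \<bar>g a\<bar>"
    using zero by (cases "S = 0") auto
  finally show "(\<Sum>b\<in>F. \<bar>transport F g a b\<bar>) = \<bar>g a\<bar>" .
qed

context
  fixes \<mu> :: "'m measure" and T :: "'e::real_normed_vector \<Rightarrow> 'm \<Rightarrow> real"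
  assumes T: "isometry_onto_L1 \<mu> T"
begin

lemma L1_isometry_integrable: "integrable \<mu> (T u)"
  and L1_isometry_add: "AE t in \<mu>. T (u + v) t = T u t + T v t"
  and L1_isometry_scale: "AE t in \<mu>. T (c *\<^sub>R u) t = c * T u t"
  and L1_isometry_norm: "(LINT t|\<mu>. \<bar>T u t\<bar>) = norm u"
  and L1_isometry_onto: "integrable \<mu> g \<Longrightarrow> \<exists>u. AE t in \<mu>. T u t = g t"
  using T by (auto simp: isometry_onto_L1_def)

lemma L1_isometry_sum:
  "AE t in \<mu>. T (\<Sum>a\<in>F. x a) t = (\<Sum>a\<in>F. T (x a) t)"
proof (induction F rule: infinite_finite_induct)
  case (insert a F)
  then show ?case
    using L1_isometry_add[of "x a" "sum x F"] by auto
qed (use L1_isometry_scale[of 0 0] in auto)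

text \<open>Carries identities that hold almost everywhere back to the normed space: the norm of the
  difference is the integral of a function vanishing almost everywhere.\<close>

lemma L1_isometry_inj:
  assumes "AE t in \<mu>. T x t = T y t"
  shows "x = y"
proof -
  have "AE t in \<mu>. T (x + (- 1) *\<^sub>R y) t = 0"
    using assms L1_isometry_add[of x "(- 1) *\<^sub>R y"] L1_isometry_scale[of "- 1" y] by eventually_elim simp
  then have "AE t in \<mu>. \<bar>T (x + (- 1) *\<^sub>R y) t\<bar> = 0"
    by eventually_elim simp
  then have "norm (x + (- 1) *\<^sub>R y) = 0"
    using integral_cong_AE[of "\<lambda>t. \<bar>T (x + (- 1) *\<^sub>R y) t\<bar>" \<mu> "\<lambda>t. 0"]
      L1_isometry_norm[of "x + (- 1) *\<^sub>R y"]
      borel_measurable_integrable[OF L1_isometry_integrable[of "x + (- 1) *\<^sub>R y"]] by simp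
  then show ?thesis by simp
qed

text \<open>The values \<open>T (u a) t\<close> are transported separately at each \<open>t\<close>;
  surjectivity of \<open>T\<close> turns the resulting functions into vectors, and injectivity turns
  the pointwise identities into identities of vectors.\<close>

lemma zero_sum_splitting:
  fixes u :: "'i \<Rightarrow> 'e"
  assumes F: "finite F" and u: "(\<Sum>a\<in>F. u a) = 0"
  shows "\<exists>v. (\<forall>a\<in>F. \<forall>b\<in>F. v b a = - v a b) \<and> (\<forall>a\<in>F. (\<Sum>b\<in>F. v a b) = u a) \<and>
    (\<forall>a\<in>F. (\<Sum>b\<in>F. norm (v a b)) = norm (u a))"
proof -
  define w where "w a b t = transport F (\<lambda>c. T (u c) t) a b" for a b t
  have [measurable]: "T x \<in> borel_measurable \<mu>" for x
    by (intro borel_measurable_integrable L1_isometry_integrable)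
  have AE0: "AE t in \<mu>. (\<Sum>a\<in>F. T (u a) t) = 0"
    using L1_isometry_sum[of u F] L1_isometry_scale[of 0 0] u by auto
  have sums: "AE t in \<mu>. (\<Sum>b\<in>F. w a b t) = T (u a) t \<and> (\<Sum>b\<in>F. \<bar>w a b t\<bar>) = \<bar>T (u a) t\<bar>"
    if "a \<in> F" for a
    using AE0 by eventually_elim (use F that in \<open>auto simp: w_def intro: transport_sums\<close>)
  \<comment> \<open>\<open>\<bar>w a b t\<bar>\<close> is one term of a row sum equal to
    \<open>\<bar>T (u a) t\<bar>\<close>, which is an integrable majorant.\<close>
  have int: "integrable \<mu> (w a b)" if "a \<in> F" "b \<in> F" for a b
  proof (rule Bochner_Integration.integrable_bound[OF L1_isometry_integrable[of "u a"]])
    show "w a b \<in> borel_measurable \<mu>"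
      unfolding w_def transport_def by measurable
    show "AE t in \<mu>. norm (w a b t) \<le> norm (T (u a) t)"
      using sums[OF that(1)]
    proof eventually_elim
      case (elim t)
      have "\<bar>w a b t\<bar> \<le> (\<Sum>b\<in>F. \<bar>w a b t\<bar>)"
        using that F by (intro member_le_sum) auto
      then show ?case
        using elim by simp
    qed
  qed
  then have "\<forall>a b. \<exists>v. a \<in> F \<longrightarrow> b \<in> F \<longrightarrow> (AE t in \<mu>. T v t = w a b t)"
    using L1_isometry_onto by blast
  then obtain v where v: "\<And>a b. a \<in> F \<Longrightarrow> b \<in> F \<Longrightarrow> AE t in \<mu>. T (v a b) t = w a b t"
    by metis
  show ?thesis
  proof (intro exI[of _ v] conjI ballI)
    fix a assume a: "a \<in> F"
    have v_all: "AE t in \<mu>. \<forall>b\<in>F. T (v a b) t = w a b t"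
      using v[OF a] F by (simp add: AE_finite_all)
    have "AE t in \<mu>. T (\<Sum>b\<in>F. v a b) t = T (u a) t"
      using L1_isometry_sum[of "v a" F] v_all sums[OF a] by eventually_elim simp
    then show "(\<Sum>b\<in>F. v a b) = u a"
      by (rule L1_isometry_inj)
    have "(\<Sum>b\<in>F. norm (v a b)) = (LINT t|\<mu>. (\<Sum>b\<in>F. \<bar>T (v a b) t\<bar>))"
      by (subst Bochner_Integration.integral_sum)
        (auto simp: L1_isometry_norm L1_isometry_integrable)
    also have "\<dots> = (LINT t|\<mu>. \<bar>T (u a) t\<bar>)"
    proof (rule integral_cong_AE)
      show "AE t in \<mu>. (\<Sum>b\<in>F. \<bar>T (v a b) t\<bar>) = \<bar>T (u a) t\<bar>"
        using v_all sums[OF a] by eventually_elim simp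
    qed measurable
    also have "\<dots> = norm (u a)"
      by (rule L1_isometry_norm)
    finally show "(\<Sum>b\<in>F. norm (v a b)) = norm (u a)" .
  next
    fix a b assume ab: "a \<in> F" "b \<in> F"
    have "AE t in \<mu>. T (v b a) t = T ((- 1) *\<^sub>R v a b) t"
      using v[OF ab] v[OF ab(2,1)] L1_isometry_scale[of "- 1" "v a b"]
      by eventually_elim (simp add: w_def transport_swap[of F _ b a])
    then show "v b a = - v a b"
      using L1_isometry_inj by fastforce
  qed
qed

end

section \<open>Centres in Lindenstrauss spaces\<close>

lemma lindenstrauss_zero_sum_bound:
  fixes u :: "'i \<Rightarrow> 'y::banach \<Rightarrow>\<^sub>L real" and y :: "'i \<Rightarrow> 'y"
  assumes "lindenstrauss_space TYPE('y) \<mu>" and F: "finite F" and u: "(\<Sum>a\<in>F. u a) = 0"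
    and r: "\<And>a b. a \<in> F \<Longrightarrow> b \<in> F \<Longrightarrow> dist (y a) (y b) \<le> 2 * r"
  shows "(\<Sum>a\<in>F. u a (y a)) \<le> r * (\<Sum>a\<in>F. norm (u a))"
proof -
  obtain T :: "('y \<Rightarrow>\<^sub>L real) \<Rightarrow> _" where "isometry_onto_L1 \<mu> T"
    using assms(1) by (auto simp: lindenstrauss_space_def)
  from zero_sum_splitting[OF this F u] obtain v where
    swap: "\<forall>a\<in>F. \<forall>b\<in>F. v b a = - v a b" and
    sum: "\<forall>a\<in>F. (\<Sum>b\<in>F. v a b) = u a" and
    norm: "\<forall>a\<in>F. (\<Sum>b\<in>F. norm (v a b)) = norm (u a)"
    by (elim exE conjE)
  have eq: "(\<Sum>a\<in>F. u a (y a)) = (\<Sum>a\<in>F. \<Sum>b\<in>F. v a b (y a))"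
    by (intro sum.cong) (simp_all add: blinfun.sum_left flip: sum[rule_format])
  \<comment> \<open>Exchanging the indices and using antisymmetry replaces \<open>y a\<close> by
    \<open>- y b\<close>; adding both forms leaves only differences, of norm at most
    \<open>2 * r\<close>.\<close>
  also have "\<dots> = (\<Sum>a\<in>F. \<Sum>b\<in>F. v b a (y b))"
    by (rule sum.swap)
  also have "\<dots> = - (\<Sum>a\<in>F. \<Sum>b\<in>F. v a b (y b))"
    unfolding sum_negf[symmetric] by (intro sum.cong refl) (metis swap blinfun.minus_left)
  finally have "2 * (\<Sum>a\<in>F. u a (y a)) = (\<Sum>a\<in>F. \<Sum>b\<in>F. v a b (y a - y b))"
    using eq by (simp add: blinfun.diff_right sum_subtractf)
  also have "\<dots> \<le> (\<Sum>a\<in>F. \<Sum>b\<in>F. norm (v a b) * (2 * r))"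
  proof (intro sum_mono)
    fix a b assume "a \<in> F" "b \<in> F"
    then have "norm (v a b) * norm (y a - y b) \<le> norm (v a b) * (2 * r)"
      using r[of a b] by (intro mult_left_mono) (auto simp: dist_norm)
    then show "v a b (y a - y b) \<le> norm (v a b) * (2 * r)"
      using norm_blinfun[of "v a b" "y a - y b"] by simp
  qed
  also have "\<dots> = 2 * (r * (\<Sum>a\<in>F. norm (u a)))"
    by (simp add: sum_distrib_right[symmetric] norm)
  finally show ?thesis by simp
qed

text \<open>The norm may fail to be attained on the unit ball, hence the loss \<open>e\<close>. If
  all values there stayed below \<open>norm f - e\<close>, rescaling would make this a bound for the
  norm.\<close>

lemma blinfun_almost_norming:
  fixes f :: "'a::real_normed_vector \<Rightarrow>\<^sub>L real"
  assumes "e > 0"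
  obtains x where "norm x \<le> 1" "norm f - e \<le> f x"
proof -
  have False if less: "\<And>x. norm x \<le> 1 \<Longrightarrow> f x < norm f - e"
  proof -
    have pos: "norm f - e \<ge> 0"
      using less[of 0] by simp
    have le: "f x \<le> (norm f - e) * norm x" for x
    proof (cases "x = 0")
      case False
      then show ?thesis
        using less[of "(1 / norm x) *\<^sub>R x"] by (simp add: blinfun.scaleR_right field_simps)
    qed simp
    have "norm f \<le> norm f - e"
      using pos
    proof (rule norm_blinfun_bound)
      show "norm (f x) \<le> (norm f - e) * norm x" for x
        using le[of x] le[of "- x"] by (simp add: blinfun.minus_right)
    qed
    then show False
      using assms by simp
  qed
  then show thesis
    using that by (meson not_le)
qed

text \<open>A centre is a point of the diagonal near the family of all \<open>a\<close> in
  \<open>F\<close>. The distance to the diagonal is the value of a functional of norm at most 1 that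
  vanishes on it; its coordinates \<open>u a\<close> sum to 0, so the zero-sum bound
  applies.\<close>

lemma lindenstrauss_finite_center:
  fixes F :: "'y::banach set"
  assumes Y: "lindenstrauss_space TYPE('y) \<mu>" and F: "finite F"
    and r: "\<And>a b. a \<in> F \<Longrightarrow> b \<in> F \<Longrightarrow> dist a b \<le> 2 * r" and s: "r < s"
  obtains y where "\<And>a. a \<in> F \<Longrightarrow> dist a y < s"
proof (cases "F = {}")
  case False
  \<comment> \<open>\<open>Y\<^sup>F\<close> with the maximum norm, as a subspace of the bounded sequences: \<open>E v\<close> is the family
    \<open>(v a)\<^bsub>a\<in>F\<^esub>\<close> read along an enumeration \<open>g\<close> of \<open>F\<close>.\<close>
  define g where "g = from_nat_into F"
  have g: "g k \<in> F" for k
    using False by (simp add: g_def from_nat_into)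
  have g_surj: "\<exists>k. a = g k" if "a \<in> F" for a
    using that F from_nat_into_surj[of F a] by (auto simp: g_def countable_finite)
  define E :: "('y \<Rightarrow> 'y) \<Rightarrow> nat \<Rightarrow>\<^sub>C 'y" where "E v = Bcontfun (\<lambda>k. v (g k))" for v
  have E: "E v k = v (g k)" for v k
  proof -
    have "finite (range (\<lambda>k. v (g k)))"
      using g by (intro finite_subset[OF _ finite_imageI[OF F, of v]]) auto
    then have "(\<lambda>k. v (g k)) \<in> bcontfun"
      by (simp add: bcontfun_def continuous_on_discrete finite_imp_bounded)
    then show ?thesis
      by (simp add: E_def Bcontfun_inverse)
  qed
  have norm_E: "norm (E v) \<le> b" if "\<And>a. a \<in> F \<Longrightarrow> norm (v a) \<le> b" for v b
    using that g by (intro norm_bound) (simp add: E)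
  have E_add: "E (\<lambda>a. v a + w a) = E v + E w" for v w
    by (rule bcontfun_eqI) (simp add: E)
  have E_scale: "E (\<lambda>a. c *\<^sub>R v a) = c *\<^sub>R E v" for c v
    by (rule bcontfun_eqI) (simp add: E)
  have E_0: "E (\<lambda>a. 0) = 0"
    by (rule bcontfun_eqI) (simp add: E)
  have E_sum: "E (\<lambda>a. \<Sum>b\<in>B. v b a) = (\<Sum>b\<in>B. E (v b))" for v and B :: "'y set"
    by (induction B rule: infinite_finite_induct) (simp_all add: E_0 E_add)
  define S where "S = range (\<lambda>y. E (\<lambda>a. y))"
  have "subspace S"
    unfolding subspace_def S_def
  proof (intro conjI ballI allI)
    show "0 \<in> range (\<lambda>y. E (\<lambda>a. y))"
      by (metis E_0 rangeI)
  qed (auto simp flip: E_add E_scale)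
  then obtain L where L: "linear L" "\<And>x. L x \<le> norm x" "\<And>x. x \<in> S \<Longrightarrow> L x = 0"
      "L (E (\<lambda>a. a)) = infdist (E (\<lambda>a. a)) S"
    using functional_attaining_infdist[of S "E (\<lambda>a. a)"] by blast
  \<comment> \<open>\<open>D a\<close> places a vector in coordinate \<open>a\<close>, so that
    \<open>u a\<close> is \<open>L\<close> restricted to that coordinate.\<close>
  define D where "D a y = E (\<lambda>b. if b = a then y else 0)" for a y
  have D_add: "D a (x + y) = D a x + D a y" for a x y
    unfolding D_def E_add[symmetric] by (rule arg_cong[of _ _ E]) auto
  have D_scale: "D a (c *\<^sub>R x) = c *\<^sub>R D a x" for a c x
    unfolding D_def E_scale[symmetric] by (rule arg_cong[of _ _ E]) auto
  have D_norm: "norm (D a y) \<le> norm y" for a y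
    unfolding D_def by (intro norm_E) auto
  have "bounded_linear (\<lambda>y. L (D a y))" for a
  proof (rule bounded_linear_intro[of _ 1])
    show "norm (L (D a y)) \<le> norm y * 1" for y
      using L(2)[of "D a y"] L(2)[of "- D a y"] D_norm[of a y] linear_neg[OF L(1), of "D a y"]
      by simp
  qed (simp_all add: D_add D_scale linear_add[OF L(1)] linear_scale[OF L(1)])
  moreover define u where "u a = Blinfun (\<lambda>y. L (D a y))" for a
  ultimately have u: "u a y = L (D a y)" for a y
    by (simp add: bounded_linear_Blinfun_apply)
  have L_E: "L (E v) = (\<Sum>a\<in>F. u a (v a))" for v
  proof -
    have "E v = (\<Sum>a\<in>F. D a (v a))"
      unfolding D_def E_sum[symmetric] using F g by (intro bcontfun_eqI) (simp add: E)
    then show ?thesis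
      by (simp add: u linear_sum[OF L(1)])
  qed
  have "(\<Sum>a\<in>F. u a) = 0"
  proof (rule blinfun_eqI)
    fix y
    show "(\<Sum>a\<in>F. u a) y = (0 :: 'y \<Rightarrow>\<^sub>L real) y"
      using L_E[of "\<lambda>a. y"] L(3)[of "E (\<lambda>a. y)"] by (simp add: S_def blinfun.sum_left)
  qed
  then have "(\<Sum>a\<in>F. u a a) \<le> r * (\<Sum>a\<in>F. norm (u a))"
    using lindenstrauss_zero_sum_bound[OF Y F, of u "\<lambda>a. a" r] r by simp
  \<comment> \<open>The dual of the maximum norm is the sum of the norms: nearly norming vectors
    \<open>x a\<close> form one family of maximum norm at most 1, with total loss
    \<open>e\<close>.\<close>
  moreover have "(\<Sum>a\<in>F. norm (u a)) \<le> 1"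
  proof (rule field_le_epsilon)
    fix e :: real assume "e > 0"
    then have "e / card F > 0"
      using F False by (simp add: card_gt_0_iff)
    then have "\<exists>x. norm x \<le> 1 \<and> norm (u a) - e / card F \<le> u a x" for a
      using blinfun_almost_norming[of "e / card F" "u a"] by metis
    then obtain x where x: "\<And>a. norm (x a) \<le> 1" "\<And>a. norm (u a) - e / card F \<le> u a (x a)"
      by metis
    have "(\<Sum>a\<in>F. norm (u a)) - e = (\<Sum>a\<in>F. norm (u a) - e / card F)"
      using F False by (simp add: sum_subtractf)
    also have "\<dots> \<le> L (E x)"
      unfolding L_E by (intro sum_mono x)
    also have "\<dots> \<le> 1"
      using L(2)[of "E x"] norm_E[of x 1] x(1) by simp
    finally show "(\<Sum>a\<in>F. norm (u a)) \<le> 1 + e" by simp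
  qed
  moreover have "r \<ge> 0"
    using r False by force
  ultimately have "infdist (E (\<lambda>a. a)) S < s"
    using s L_E[of "\<lambda>a. a"] L(4) mult_left_le[of "\<Sum>a\<in>F. norm (u a)" r] by simp
  \<comment> \<open>The strict bound yields a point of the diagonal even if the infimum is not
    attained.\<close>
  then obtain y where y: "dist (E (\<lambda>a. a)) (E (\<lambda>a. y)) < s"
    by (auto simp: S_def infdist_notempty cINF_less_iff)
  show thesis
  proof (rule that)
    fix a assume "a \<in> F"
    then obtain k where "a = g k"
      using g_surj by blast
    then show "dist a y < s"
      using dist_bounded[of "E (\<lambda>a. a)" k "E (\<lambda>a. y)"] y by (simp add: E)
  qed
qed simp

lemma lindenstrauss_totally_bounded_center:
  fixes A :: "'y::banach set"
  assumes Y: "lindenstrauss_space TYPE('y) \<mu>" and A: "Met_TC.mtotally_bounded A"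
    and r: "\<And>a b. a \<in> A \<Longrightarrow> b \<in> A \<Longrightarrow> dist a b \<le> 2 * r" and s: "r < s"
  obtains y where "\<And>a. a \<in> A \<Longrightarrow> dist a y < s"
proof -
  \<comment> \<open>Half of the slack enlarges the ball around the finite net, the other half pays
    for approximation by the net.\<close>
  define e where "e = (s - r) / 2"
  have "e > 0"
    using s by (simp add: e_def)
  then obtain F where F: "finite F" "F \<subseteq> A" "A \<subseteq> (\<Union>x\<in>F. ball x e)"
    using A by (auto simp: Met_TC.mtotally_bounded_def)
  have "dist a b \<le> 2 * r" if "a \<in> F" "b \<in> F" for a b
    using r F(2) that by blast
  then obtain y where y: "\<And>a. a \<in> F \<Longrightarrow> dist a y < r + e"
    using lindenstrauss_finite_center[OF Y F(1), of r "r + e"] \<open>e > 0\<close> by fastforce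
  show thesis
  proof (rule that)
    fix a assume "a \<in> A"
    then obtain b where "b \<in> F" "dist b a < e"
      using F(3) by auto
    then have "dist a y < r + 2 * e"
      using y[of b] dist_triangle[of a y b] by (simp add: dist_commute)
    then show "dist a y < s"
      by (simp add: e_def field_simps)
  qed
qed

section \<open>Kuratowski measure and total boundedness\<close>

lemma kuratowski_mnc_le_bound:
  assumes "A \<subseteq> X" "B > 0" "\<And>x y. x \<in> A \<Longrightarrow> y \<in> A \<Longrightarrow> d x y \<le> B"
  shows "kuratowski_mnc X d A \<le> B"
  unfolding kuratowski_mnc_def
proof (rule cInf_lower)
  show "B \<in> {\<epsilon>. \<epsilon> > 0 \<and> (\<exists>\<C>. finite \<C> \<and> (\<forall>S\<in>\<C>. S \<subseteq> X \<and> ediam d S \<le> ennreal \<epsilon>) \<and> A \<subseteq> \<Union>\<C>)}"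
    using assms by (auto simp: ediam_def intro!: exI[of _ "{A}"] SUP_least ennreal_leI)
qed (auto intro: bdd_belowI[of _ 0])

text \<open>Cover sets are cut down to \<open>A\<close> and empty ones dropped, so that points
  chosen from the pieces exist and lie in \<open>A\<close>. The bound \<open>B\<close> makes the set
  under the infimum nonempty.\<close>

lemma kuratowski_mnc_less_cover:
  assumes A: "A \<subseteq> X" "\<And>x y. x \<in> A \<Longrightarrow> y \<in> A \<Longrightarrow> d x y \<le> B" and less: "kuratowski_mnc X d A < e"
  shows "\<exists>\<C>. finite \<C> \<and> \<Union>\<C> = A \<and> {} \<notin> \<C> \<and> (\<forall>S\<in>\<C>. \<forall>x\<in>S. \<forall>y\<in>S. d x y \<le> e)"
proof -
  define K where "K = {\<epsilon>. \<epsilon> > 0 \<and>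
    (\<exists>\<C>. finite \<C> \<and> (\<forall>S\<in>\<C>. S \<subseteq> X \<and> ediam d S \<le> ennreal \<epsilon>) \<and> A \<subseteq> \<Union>\<C>)}"
  \<comment> \<open>The maximum with 1 guarantees a positive value, since \<open>B\<close> itself
    may not be positive.\<close>
  have "ediam d A \<le> ennreal (max B 1)"
    using A(2) unfolding ediam_def by (intro SUP_least ennreal_leI max.coboundedI1)
  then have "max B 1 \<in> K"
    using A(1) unfolding K_def by (intro CollectI conjI exI[of _ "{A}"]) auto
  then obtain \<epsilon> where \<epsilon>: "\<epsilon> \<in> K" "\<epsilon> < e"
    using cInf_lessD[of K e] less unfolding kuratowski_mnc_def K_def[symmetric] by auto
  then obtain \<C> where *: "0 < \<epsilon>" "\<epsilon> < e" "finite \<C>" "\<forall>S\<in>\<C>. ediam d S \<le> ennreal \<epsilon>" "A \<subseteq> \<Union>\<C>"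
    unfolding K_def by auto
  show ?thesis
  proof (intro exI[of _ "(\<lambda>S. S \<inter> A) ` \<C> - {{}}"] conjI ballI)
    show "\<Union>((\<lambda>S. S \<inter> A) ` \<C> - {{}}) = A"
      using *(5) by blast
  next
    fix S x y assume "S \<in> (\<lambda>S. S \<inter> A) ` \<C> - {{}}" "x \<in> S" "y \<in> S"
    then obtain S' where S': "S' \<in> \<C>" "x \<in> S'" "y \<in> S'"
      by blast
    then have "ennreal (d x y) \<le> ediam d S'"
      unfolding ediam_def by (meson SUP_upper2 order_refl)
    then have "ennreal (d x y) \<le> ennreal \<epsilon>"
      using *(4) S'(1) order_trans by blast
    then show "d x y \<le> e"
      using *(1,2) by simp
  qed (use *(3) in auto)
qed

text \<open>One point from each piece gives a finite net in \<open>A\<close>; diameter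
  \<open>e / 2\<close> secures the strict inequality of open balls.\<close>

lemma mtotally_bounded_if_kuratowski_mnc_zero:
  fixes A :: "'y::metric_space set"
  assumes "bounded A" "kuratowski_mnc UNIV dist A \<le> 0"
  shows "Met_TC.mtotally_bounded A"
  unfolding Met_TC.mtotally_bounded_def
proof (intro allI impI)
  fix e :: real assume e: "e > 0"
  obtain B where "\<And>x y. x \<in> A \<Longrightarrow> y \<in> A \<Longrightarrow> dist x y \<le> B"
    using assms(1) unfolding bounded_two_points by blast
  then have "\<exists>\<C>. finite \<C> \<and> \<Union>\<C> = A \<and> {} \<notin> \<C> \<and> (\<forall>S\<in>\<C>. \<forall>x\<in>S. \<forall>y\<in>S. dist x y \<le> e / 2)"
    using assms(2) e by (intro kuratowski_mnc_less_cover[of A UNIV dist B]) auto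
  then obtain \<C> where \<C>: "finite \<C>" "\<Union>\<C> = A" "{} \<notin> \<C>"
      "\<forall>S\<in>\<C>. \<forall>x\<in>S. \<forall>y\<in>S. dist x y \<le> e / 2"
    by blast
  have "\<forall>S\<in>\<C>. \<exists>x. x \<in> S"
    using \<C>(3) by (metis ex_in_conv)
  then obtain c where c: "\<And>S. S \<in> \<C> \<Longrightarrow> c S \<in> S"
    by metis
  show "\<exists>K. finite K \<and> K \<subseteq> A \<and> A \<subseteq> (\<Union>x\<in>K. Met_TC.mball x e)"
  proof (intro exI[of _ "c ` \<C>"] conjI subsetI)
    fix x assume "x \<in> A"
    then obtain S where S: "S \<in> \<C>" "x \<in> S"
      using \<C>(2) by blast
    then have "dist (c S) x < e"
      using \<C>(4) c[OF S(1)] e by fastforce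
    then show "x \<in> (\<Union>x\<in>c ` \<C>. Met_TC.mball x e)"
      using S(1) by auto
  qed (use \<C> c in auto)
qed

section \<open>Bounded functions and the comparison of the two measures\<close>

lemma dist_le_sup_dist:
  assumes "f \<in> bounded_funs \<Omega>" "g \<in> bounded_funs \<Omega>" "x \<in> \<Omega>"
  shows "dist (f x) (g x) \<le> sup_dist \<Omega> f g"
  using Met_TC.funspace_mdist_le[OF assms(1,2), of "sup_dist \<Omega> f g"] assms(3) by auto

lemma pointwise_relatively_compact_totally_bounded:
  fixes M :: "('w \<Rightarrow> 'y::real_normed_vector) set"
  assumes M: "M \<subseteq> bounded_funs \<Omega>" "Metric_space.mbounded (bounded_funs \<Omega>) (sup_dist \<Omega>) M"
    and rc: "pointwise_relatively_compact \<Omega> M" and x: "x \<in> \<Omega>"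
  shows "Met_TC.mtotally_bounded ((\<lambda>f. f x) ` M)"
proof (rule mtotally_bounded_if_kuratowski_mnc_zero)
  obtain B where "B > 0" and B_sup: "\<And>f g. f \<in> M \<Longrightarrow> g \<in> M \<Longrightarrow> sup_dist \<Omega> f g \<le> B"
    using M(2) unfolding Metric_space.mbounded_alt_pos[OF Met_TC.Metric_space_funspace] by blast
  have B: "dist (f z) (g z) \<le> B" if "f \<in> M" "g \<in> M" "z \<in> \<Omega>" for f g z
  proof -
    have "f \<in> bounded_funs \<Omega>" "g \<in> bounded_funs \<Omega>"
      using that M(1) by blast+
    then have "dist (f z) (g z) \<le> sup_dist \<Omega> f g"
      using that(3) by (rule dist_le_sup_dist)
    also have "\<dots> \<le> B"
      using that by (intro B_sup)
    finally show ?thesis .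
  qed
  then show "bounded ((\<lambda>f. f x) ` M)"
    using x unfolding bounded_two_points by blast
  \<comment> \<open>The bound is uniform in \<open>z\<close>: only for a family bounded above does a
    real supremum equal to 0 force every member to be at most 0.\<close>
  have "kuratowski_mnc UNIV dist ((\<lambda>f. f z) ` M) \<le> B" if "z \<in> \<Omega>" for z
    using B that \<open>B > 0\<close> by (intro kuratowski_mnc_le_bound) auto
  then have "bdd_above ((\<lambda>z. kuratowski_mnc UNIV dist ((\<lambda>f. f z) ` M)) ` \<Omega>)"
    by (rule bdd_aboveI2)
  then show "kuratowski_mnc UNIV dist ((\<lambda>f. f x) ` M) \<le> 0"
    using cSUP_upper[OF x] rc unfolding pointwise_relatively_compact_def by fastforce
qed

theorem proposition5p1:
  fixes \<Omega> :: "'w set"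
    and M :: "('w \<Rightarrow> 'y::banach) set"
    and \<mu> :: "'m measure"
  assumes "\<Omega> \<noteq> {}"
    and "lindenstrauss_space TYPE('y) \<mu>"
    and "M \<subseteq> bounded_funs \<Omega>"
    and "M \<noteq> {}"
    and "Metric_space.mbounded (bounded_funs \<Omega>) (sup_dist \<Omega>) M"
    and "pointwise_relatively_compact \<Omega> M"
  shows "omega_B \<Omega> M \<le> kuratowski_mnc (bounded_funs \<Omega>) (sup_dist \<Omega>) M"
proof (rule dense_ge)
  fix e assume "kuratowski_mnc (bounded_funs \<Omega>) (sup_dist \<Omega>) M < e"
  \<comment> \<open>\<open>e'\<close> bounds the diameters of the pieces; the gap up to
    \<open>e\<close> pays for centres of radius \<open>e / 2\<close> instead of
    \<open>e' / 2\<close>.\<close>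
  then obtain e' where e': "kuratowski_mnc (bounded_funs \<Omega>) (sup_dist \<Omega>) M < e'" "e' < e"
    using dense by blast
  obtain B where "\<And>f g. f \<in> M \<Longrightarrow> g \<in> M \<Longrightarrow> sup_dist \<Omega> f g \<le> B"
    using assms(5) unfolding Metric_space.mbounded_alt[OF Met_TC.Metric_space_funspace] by blast
  then have "\<exists>\<C>. finite \<C> \<and> \<Union>\<C> = M \<and> {} \<notin> \<C> \<and>
      (\<forall>S\<in>\<C>. \<forall>f\<in>S. \<forall>g\<in>S. sup_dist \<Omega> f g \<le> e')"
    by (intro kuratowski_mnc_less_cover[OF assms(3) _ e'(1)])
  then obtain \<C> where \<C>: "finite \<C>" "\<Union>\<C> = M" "{} \<notin> \<C>"
      "\<forall>S\<in>\<C>. \<forall>f\<in>S. \<forall>g\<in>S. sup_dist \<Omega> f g \<le> e'"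
    by blast
  have dist_le: "dist (f x) (g x) \<le> 2 * (e' / 2)" if "S \<in> \<C>" "f \<in> S" "g \<in> S" "x \<in> \<Omega>" for S f g x
  proof -
    have "f \<in> bounded_funs \<Omega>" "g \<in> bounded_funs \<Omega>"
      using that \<C>(2) assms(3) by blast+
    then have "dist (f x) (g x) \<le> sup_dist \<Omega> f g"
      using that(4) by (rule dist_le_sup_dist)
    also have "\<dots> \<le> e'"
      using \<C>(4) that by blast
    finally show ?thesis by simp
  qed
  have "\<exists>y. \<forall>f\<in>S. dist (f x) y < e / 2" if S: "S \<in> \<C>" and x: "x \<in> \<Omega>" for S x
  proof -
    have "Met_TC.mtotally_bounded ((\<lambda>f. f x) ` S)"
      using S \<C>(2) pointwise_relatively_compact_totally_bounded[OF assms(3,5,6) x]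
      by (auto intro: Met_TC.mtotally_bounded_subset)
    moreover have "dist a b \<le> 2 * (e' / 2)" if "a \<in> (\<lambda>f. f x) ` S" "b \<in> (\<lambda>f. f x) ` S" for a b
      using dist_le[OF S _ _ x] that by blast
    moreover have "e' / 2 < e / 2"
      using e'(2) by simp
    ultimately obtain y where "\<And>a. a \<in> (\<lambda>f. f x) ` S \<Longrightarrow> dist a y < e / 2"
      using lindenstrauss_totally_bounded_center[OF assms(2)] by blast
    then show ?thesis by blast
  qed
  then obtain c where c: "\<And>S x f. S \<in> \<C> \<Longrightarrow> x \<in> \<Omega> \<Longrightarrow> f \<in> S \<Longrightarrow> dist (f x) (c S x) < e / 2"
    by metis
  \<comment> \<open>Restriction makes \<open>\<phi> S\<close> extensional, as
    \<open>bounded_funs \<Omega>\<close> requires.\<close>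
  define \<phi> where "\<phi> S = restrict (c S) \<Omega>" for S
  \<comment> \<open>A piece is nonempty, and \<open>c S\<close> stays within \<open>e / 2\<close> of
    any one of its bounded members.\<close>
  have \<phi>: "\<phi> S \<in> bounded_funs \<Omega>" if S: "S \<in> \<C>" for S
  proof -
    obtain f where f: "f \<in> S"
      using S \<C>(3) by (metis ex_in_conv)
    then have "bounded (f ` \<Omega>)"
      using S \<C>(2) assms(3) by (auto simp: Met_TC.fspace_def)
    then obtain b where b: "\<And>x. x \<in> \<Omega> \<Longrightarrow> norm (f x) \<le> b"
      by (auto simp: bounded_iff)
    have "norm (c S x) \<le> b + e / 2" if x: "x \<in> \<Omega>" for x
      using c[OF S x f] b[OF x] norm_triangle_sub[of "c S x" "f x"]
      by (simp add: dist_norm norm_minus_commute)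
    then show ?thesis
      by (auto simp: \<phi>_def Met_TC.fspace_def bounded_iff)
  qed
  obtain S f where "S \<in> \<C>" "f \<in> S"
    using assms(4) \<C>(2) by blast
  moreover obtain x where "x \<in> \<Omega>"
    using assms(1) by blast
  ultimately have "e > 0"
    using c[of S x f] zero_le_dist[of "f x" "c S x"] by linarith
  \<comment> \<open>On a piece, \<open>f - \<phi> S\<close> takes values in the ball of radius
    \<open>e / 2\<close> about 0, so \<open>\<Omega>\<close> can stay undivided.\<close>
  have diam: "diameter ((\<lambda>x. f x - \<phi> S x) ` \<Omega>) \<le> e" if S: "S \<in> \<C>" and f: "f \<in> S" for S f
  proof (rule diameter_le)
    fix v w assume "v \<in> (\<lambda>x. f x - \<phi> S x) ` \<Omega>" "w \<in> (\<lambda>x. f x - \<phi> S x) ` \<Omega>"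
    then have "norm v < e / 2" "norm w < e / 2"
      using c[OF S _ f] by (auto simp: \<phi>_def dist_norm)
    then show "norm (v - w) \<le> e"
      using norm_triangle_ineq4[of v w] by simp
  qed (use assms(1) in simp)
  show "omega_B \<Omega> M \<le> e"
    unfolding omega_B_def
  proof (rule cInf_lower)
    have "partition_on \<Omega> {\<Omega>}"
      using assms(1) by (simp add: partition_on_def)
    moreover have "\<forall>f\<in>M. \<exists>g\<in>\<phi> ` \<C>. \<forall>A\<in>{\<Omega>}. diameter ((\<lambda>x. f x - g x) ` A) \<le> e"
      using diam \<C>(2) by blast
    ultimately show "e \<in> {\<epsilon>. \<epsilon> > 0 \<and>
            (\<exists>\<A> \<Phi>. finite \<A> \<and> partition_on \<Omega> \<A> \<and> finite \<Phi> \<and> \<Phi> \<subseteq> bounded_funs \<Omega> \<and>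
               (\<forall>f\<in>M. \<exists>\<phi>\<in>\<Phi>. \<forall>A\<in>\<A>. diameter ((\<lambda>x. f x - \<phi> x) ` A) \<le> \<epsilon>))}"
      using \<open>e > 0\<close> \<C>(1) \<phi> by (intro CollectI conjI exI[of _ "{\<Omega>}"] exI[of _ "\<phi> ` \<C>"]) auto
  qed (auto intro: bdd_belowI[of _ 0])
qed

end
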